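(* Let $\lambda$ be a nonzero real number and $F(t)=\frac{\lambda}{(1+t)^\lambda-1}$. For each integer $N\ge1$, let $a_{i,\lambda}(N)$, $0\le i\le N$, be the coefficients for which $$F^{(N)}(t)=\left(\frac{-1}{1+t}\right)^N\sum_{i=0}^N a_{i,\lambda}(N)\,F(t)^{i+1}.$$ Then for $0\le i\le N$, $$a_{i,\lambda}(N)=(-1)^N\lambda^{-i}\sum_{k=i}^N\sum_{l=0}^k(-1)^l\binom{k}{i}\binom{k}{l}(\lambda l)_N=(-1)^N\lambda^{N-i}\sum_{k=i}^N(-1)^k k!\binom{k}{i}S_{2,\frac1\lambda}(N,k).$$
   Context: $(x)_n$ is the falling factorial: $(x)_0=1$, $(x)_n=x(x-1)\cdots(x-n+1)$. For $\mu\neq 0$ and integers $n\ge k\ge 0$, the degenerate Stirling numbers of the second kind $S_{2,\mu}(n,k)$ are defined by the generating function $\frac{1}{k!}\big((1+\mu t)^{1/\mu}-1\big)^k=\sum_{n=k}^\infty S_{2,\mu}(n,k)\frac{t^n}{n!}$; here $\mu=1/\lambda$, i.e. $\frac1{k!}\big((1+t/\lambda)^{\lambda}-1\big)^k=\sum_{n\ge k}S_{2,1/\lambda}(n,k)\frac{t^n}{n!}$. *)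

theory Defs
  imports "HOL-Analysis.Analysis" "HOL-Computational_Algebra.Formal_Power_Series"
begin

definition falling_factorial :: "real \<Rightarrow> nat \<Rightarrow> real" where
  "falling_factorial x n = (\<Prod>j<n. x - real j)"

text \<open>
  The generating function is read as a formal power series in \<open>t\<close>:
  \<open>fps_binomial c\<close> is the series of \<open>(1 + t)\<close> to the power \<open>c\<close>, here with
  \<open>\<mu> t\<close> substituted for \<open>t\<close>; the factor \<open>fact n\<close> turns the ordinary
  coefficient into the coefficient of \<open>t\<^sup>n / n!\<close>.
\<close>
definition degenerate_stirling2_gf :: "real \<Rightarrow> nat \<Rightarrow> real fps" where
  "degenerate_stirling2_gf \<mu> k =
     fps_const (1 / fact k) *
       ((fps_binomial (1 / \<mu>) oo (fps_const \<mu> * fps_X)) - 1) ^ k"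

definition degenerate_stirling2 :: "real \<Rightarrow> nat \<Rightarrow> nat \<Rightarrow> real" where
  "degenerate_stirling2 \<mu> n k = fact n * fps_nth (degenerate_stirling2_gf \<mu> k) n"

definition F :: "real \<Rightarrow> real \<Rightarrow> real" where
  "F lam t = lam / ((1 + t) powr lam - 1)"

text \<open>
  For real \<open>lam \<noteq> 0\<close>, the function \<open>F lam\<close> is smooth on \<open>t > -1\<close> except for its
  pole at \<open>t = 0\<close>. The sequence \<open>a\<close> matters only at the indices \<open>i \<le> N\<close>.
\<close>
definition derivative_coeffs :: "real \<Rightarrow> nat \<Rightarrow> (nat \<Rightarrow> real) \<Rightarrow> bool" where
  "derivative_coeffs lam N a \<longleftrightarrow>
     (\<forall>t. t > -1 \<longrightarrow> t \<noteq> 0 \<longrightarrow>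
        (deriv ^^ N) (F lam) t =
          (- 1 / (1 + t)) ^ N * (\<Sum>i=0..N. a i * F lam t ^ (i + 1)))"

end

theory Submission
  imports Defs
begin

text \<open>
  Since \<open>F' = - (\<lambda> F + F\<^sup>2) / (1 + t)\<close>, differentiating the claimed expansion shows that one
  admissible family of coefficients obeys \<open>a\<^sub>i(N+1) = (N + \<lambda>(i+1)) a\<^sub>i(N) + i a\<^sub>i\<^sub>-\<^sub>1(N)\<close>, and the
  double sum satisfies the same recurrence. The coefficients are unique because \<open>F\<close> takes
  infinitely many values. The second formula follows by expanding \<open>((1 + t/\<lambda>)\<^sup>\<lambda> - 1)\<^sup>k\<close>
  binomially.
\<close>

section \<open>Finite differences of falling factorials\<close>

text \<open>Up to the sign \<open>(- 1) ^ k\<close>, the k-th forward difference at 0 of the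
  polynomial \<open>falling_factorial (lam * x) N\<close> in \<open>x\<close>.\<close>

definition falling_diff :: "real \<Rightarrow> nat \<Rightarrow> nat \<Rightarrow> real" where
  "falling_diff lam N k =
     (\<Sum>l\<le>k. (- 1) ^ l * real (k choose l) * falling_factorial (lam * real l) N)"

text \<open>Terms with \<open>k < i\<close> vanish; a range free of \<open>i\<close> lets sums for
  neighbouring \<open>i\<close> be combined in the recurrence.\<close>

definition F_coeff :: "real \<Rightarrow> nat \<Rightarrow> nat \<Rightarrow> real" where
  "F_coeff lam N i = (- 1) ^ N / lam ^ i * (\<Sum>k\<le>N. real (k choose i) * falling_diff lam N k)"

lemma falling_factorial_0 [simp]: "falling_factorial x 0 = 1"
  by (simp add: falling_factorial_def)

lemma falling_factorial_Suc: "falling_factorial x (Suc n) = falling_factorial x n * (x - real n)"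
  by (simp add: falling_factorial_def)

lemma falling_factorial_gbinomial: "falling_factorial x n = fact n * (x gchoose n)"
  by (simp add: falling_factorial_def gbinomial_prod_rev atLeast0LessThan)

lemma falling_diff_Suc_0: "falling_diff lam (Suc N) 0 = - real N * falling_diff lam N 0"
  by (simp add: falling_diff_def falling_factorial_Suc)

text \<open>Absorption followed by Pascal's rule. Avoiding the index \<open>l - 1\<close> keeps the
  identity valid at \<open>l = 0\<close>.\<close>

lemma mult_Suc_choose: "real l * real (Suc k choose l) = real (Suc k) * (real (Suc k choose l) - real (k choose l))"
proof (cases l)
  case (Suc m)
  have "real (Suc m) * real (Suc k choose Suc m) = real (Suc k) * real (k choose m)"
    by (metis Suc_times_binomial of_nat_mult)
  then show ?thesis by (simp add: Suc)
qed simp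

text \<open>Passing to \<open>Suc N\<close> multiplies each falling factorial by
  \<open>lam * real l - real N\<close>; the factor \<open>real l\<close> is absorbed into the
  binomial coefficient.\<close>

lemma falling_diff_Suc_Suc:
  "falling_diff lam (Suc N) (Suc k) =
     (lam * real (Suc k) - real N) * falling_diff lam N (Suc k) - lam * real (Suc k) * falling_diff lam N k"
proof -
  let ?f = "\<lambda>l. falling_factorial (lam * real l) N"
  \<comment> \<open>The added term has \<open>k choose Suc k = 0\<close>; now both sums run over the
    same \<open>l\<close>.\<close>
  have ext: "falling_diff lam N k = (\<Sum>l\<le>Suc k. (- 1) ^ l * real (k choose l) * ?f l)"
    by (simp add: falling_diff_def)
  have term_eq: "(- 1) ^ l * real (Suc k choose l) * falling_factorial (lam * real l) (Suc N) =
      (lam * real (Suc k) - real N) * ((- 1) ^ l * real (Suc k choose l) * ?f l)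
      - lam * real (Suc k) * ((- 1) ^ l * real (k choose l) * ?f l)" for l
  proof -
    have "(- 1) ^ l * real (Suc k choose l) * falling_factorial (lam * real l) (Suc N) =
        (- 1) ^ l * ?f l * (lam * (real l * real (Suc k choose l)) - real N * real (Suc k choose l))"
      by (simp add: falling_factorial_Suc algebra_simps)
    then show ?thesis
      unfolding mult_Suc_choose by (simp add: algebra_simps del: binomial_Suc_Suc of_nat_Suc)
  qed
  show ?thesis
    unfolding ext unfolding falling_diff_def term_eq by (simp only: sum_subtractf sum_distrib_left)
qed

text \<open>Differences of order above the degree of a polynomial vanish. The base case is an
  alternating row sum of Pascal's triangle; the recurrence does the rest.\<close>

lemma falling_diff_eq_0: "N < k \<Longrightarrow> falling_diff lam N k = 0"
proof (induction N arbitrary: k)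
  case 0
  then show ?case by (simp add: falling_diff_def choose_alternating_sum)
next
  case (Suc N)
  then obtain j where "k = Suc j" "N < j" by (cases k) auto
  with Suc.IH show ?case by (simp add: falling_diff_Suc_Suc)
qed

section \<open>Recurrence for the coefficients\<close>

lemma F_coeff_0: "F_coeff lam 0 0 = 1"
  by (simp add: F_coeff_def falling_diff_def)

lemma F_coeff_eq_0: "N < i \<Longrightarrow> F_coeff lam N i = 0"
  by (auto simp: F_coeff_def intro!: sum.neutral)

text \<open>The recurrence expands each difference and the lower-order terms are re-indexed; the
  leftover at \<open>k = Suc N\<close> vanishes because its order exceeds the degree.\<close>

lemma sum_choose_falling_diff_Suc:
  "(\<Sum>k\<le>Suc N. real (k choose i) * falling_diff lam (Suc N) k) =
     (\<Sum>k\<le>N. (real (k choose i) * (lam * real k - real N)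
               - lam * (real (Suc k) * real (Suc k choose i))) * falling_diff lam N k)"
proof -
  have "(\<Sum>k\<le>Suc N. real (k choose i) * falling_diff lam (Suc N) k) =
      (\<Sum>k\<le>Suc N. real (k choose i) * ((lam * real k - real N) * falling_diff lam N k))
      - (\<Sum>k\<le>N. real (Suc k choose i) * (lam * real (Suc k) * falling_diff lam N k))"
    by (simp only: sum.atMost_Suc_shift falling_diff_Suc_0 falling_diff_Suc_Suc right_diff_distrib
        sum_subtractf) simp
  also have "\<dots> = (\<Sum>k\<le>N. real (k choose i) * ((lam * real k - real N) * falling_diff lam N k))
      - (\<Sum>k\<le>N. real (Suc k choose i) * (lam * real (Suc k) * falling_diff lam N k))"
    by (simp add: falling_diff_eq_0)
  finally show ?thesis
    by (simp only: sum_subtractf[symmetric]) (simp only: algebra_simps)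
qed

lemma F_coeff_Suc_0: "F_coeff lam (Suc N) 0 = (real N + lam) * F_coeff lam N 0"
proof -
  have "(\<Sum>k\<le>Suc N. real (k choose 0) * falling_diff lam (Suc N) k) =
      - (real N + lam) * (\<Sum>k\<le>N. real (k choose 0) * falling_diff lam N k)"
    unfolding sum_choose_falling_diff_Suc sum_distrib_left
    by (intro sum.cong refl) (simp add: algebra_simps)
  then show ?thesis
    unfolding F_coeff_def by (simp only:) (simp add: algebra_simps)
qed

lemma F_coeff_Suc_Suc:
  assumes "lam \<noteq> 0"
  shows "F_coeff lam (Suc N) (Suc i) =
    (real N + lam * real (Suc (Suc i))) * F_coeff lam N (Suc i) + real (Suc i) * F_coeff lam N i"
proof -
  \<comment> \<open>Rewrites the multiplier over \<open>k choose Suc i\<close> and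
    \<open>k choose i\<close> with coefficients free of \<open>k\<close>, which can then leave the
    sum.\<close>
  have choose: "real k * real (k choose Suc i) - real (Suc k) * real (Suc k choose Suc i) =
      - real (Suc (Suc i)) * real (k choose Suc i) - real (Suc i) * real (k choose i)" for k
  proof -
    have "real (Suc i) * real (Suc k choose Suc i) = real (Suc k) * real (k choose i)"
      by (metis Suc_times_binomial of_nat_mult)
    then show ?thesis by (simp add: algebra_simps)
  qed
  have "(\<Sum>k\<le>Suc N. real (k choose Suc i) * falling_diff lam (Suc N) k) =
      (\<Sum>k\<le>N. (lam * (real k * real (k choose Suc i) - real (Suc k) * real (Suc k choose Suc i))
               - real N * real (k choose Suc i)) * falling_diff lam N k)"
    unfolding sum_choose_falling_diff_Suc
    by (intro sum.cong refl) (simp only: algebra_simps)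
  also have "\<dots> = - (real N + lam * real (Suc (Suc i))) * (\<Sum>k\<le>N. real (k choose Suc i) * falling_diff lam N k)
      - lam * real (Suc i) * (\<Sum>k\<le>N. real (k choose i) * falling_diff lam N k)"
    unfolding choose sum_distrib_left sum_subtractf[symmetric]
    by (intro sum.cong refl) (simp add: algebra_simps del: of_nat_Suc)
  finally show ?thesis
    using assms
    unfolding F_coeff_def by (simp only:) (simp add: field_simps del: of_nat_Suc)
qed

section \<open>The function F and its differential equation\<close>

lemma powr_ne_1:
  assumes "lam \<noteq> (0::real)" "t > -1" "t \<noteq> 0"
  shows "(1 + t) powr lam \<noteq> 1"
  using assms by (auto simp: powr_def)

lemma F_nonzero:
  assumes "lam \<noteq> 0" "t > -1" "t \<noteq> 0"
  shows "F lam t \<noteq> 0"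
  using assms powr_ne_1 by (simp add: F_def)

text \<open>Supplies the infinitely many values of \<open>F lam\<close> on which uniqueness of the
  coefficients rests.\<close>

lemma inj_on_F:
  assumes "lam \<noteq> 0"
  shows "inj_on (F lam) {t. t > -1 \<and> t \<noteq> 0}"
proof (rule inj_onI)
  fix s t assume st: "s \<in> {t. t > -1 \<and> t \<noteq> 0}" "t \<in> {t. t > -1 \<and> t \<noteq> 0}" "F lam s = F lam t"
  then have "(1 + s) powr lam = (1 + t) powr lam"
    using assms powr_ne_1[of lam s] powr_ne_1[of lam t] by (simp add: F_def field_simps)
  then have "((1 + s) powr lam) powr (1 / lam) = ((1 + t) powr lam) powr (1 / lam)"
    by simp
  then show "s = t"
    using assms st by (simp add: powr_powr)
qed

text \<open>With \<open>u = (1 + t) powr lam\<close>, both \<open>lam * F + F^2\<close> and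
  \<open>- (1 + t) * F'\<close> equal \<open>lam^2 * u / (u - 1)^2\<close>.\<close>

lemma has_field_derivative_F:
  assumes "lam \<noteq> 0" "t > -1" "t \<noteq> 0"
  shows "(F lam has_field_derivative - (lam * F lam t + F lam t ^ 2) / (1 + t)) (at t)"
proof -
  define u where "u = (1 + t) powr lam"
  have u: "u \<noteq> 1" using powr_ne_1[OF assms] by (simp add: u_def)
  have pos: "1 + t > 0" using assms by simp
  have pm: "(1 + t) powr (lam - 1) = u / (1 + t)"
    using pos by (simp add: u_def powr_diff)
  have "((\<lambda>t. lam / ((1 + t) powr lam - 1)) has_field_derivative
      - (lam * (lam * (1 + t) powr (lam - 1))) / (u - 1) ^ 2) (at t)"
    using pos u by (auto intro!: derivative_eq_intros simp: u_def power2_eq_square)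
  moreover have "- (lam * (lam * (1 + t) powr (lam - 1))) / (u - 1) ^ 2 =
      - (lam * F lam t + F lam t ^ 2) / (1 + t)"
  proof -
    have "F lam t = lam / (u - 1)" by (simp add: F_def u_def)
    moreover have "lam * (lam / (u - 1)) + (lam / (u - 1)) ^ 2 = lam * lam * u / (u - 1) ^ 2"
      using u by (simp add: divide_simps power2_eq_square) algebra
    ultimately show ?thesis unfolding pm minus_divide_left[symmetric] by (simp add: ac_simps)
  qed
  moreover have "F lam = (\<lambda>t. lam / ((1 + t) powr lam - 1))"
    by (simp add: fun_eq_iff F_def)
  ultimately show ?thesis by simp
qed

section \<open>Higher derivatives of F\<close>

text \<open>The coefficient recurrence in polynomial form,
  \<open>P_(N+1) = N * P_N + (lam * y + y^2) * P_N'\<close>, as differentiation produces it.\<close>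

lemma sum_F_coeff_Suc:
  assumes "lam \<noteq> 0"
  shows "(\<Sum>i\<le>Suc N. F_coeff lam (Suc N) i * y ^ Suc i) =
    real N * (\<Sum>i\<le>N. F_coeff lam N i * y ^ Suc i)
    + (lam * y + y ^ 2) * (\<Sum>i\<le>N. F_coeff lam N i * (real (Suc i) * y ^ i))"
proof -
  have "(\<Sum>i\<le>Suc N. F_coeff lam (Suc N) i * y ^ Suc i) =
      (\<Sum>i\<le>Suc N. (real N + lam * real (Suc i)) * F_coeff lam N i * y ^ Suc i)
      + (\<Sum>i\<le>N. real (Suc i) * F_coeff lam N i * y ^ Suc (Suc i))"
    unfolding sum.atMost_Suc_shift F_coeff_Suc_0 F_coeff_Suc_Suc[OF assms]
    by (simp add: sum.distrib[symmetric] algebra_simps del: of_nat_Suc)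
  also have "(\<Sum>i\<le>Suc N. (real N + lam * real (Suc i)) * F_coeff lam N i * y ^ Suc i) =
      (\<Sum>i\<le>N. (real N + lam * real (Suc i)) * F_coeff lam N i * y ^ Suc i)"
    by (simp add: F_coeff_eq_0)
  finally show ?thesis
    by (simp add: sum_distrib_left sum.distrib[symmetric] algebra_simps power2_eq_square)
qed

lemma higher_deriv_F:
  assumes "lam \<noteq> 0"
  shows "t > -1 \<Longrightarrow> t \<noteq> 0 \<Longrightarrow>
    (deriv ^^ N) (F lam) t = (- 1 / (1 + t)) ^ N * (\<Sum>i\<le>N. F_coeff lam N i * F lam t ^ Suc i)"
proof (induction N arbitrary: t)
  case 0
  then show ?case by (simp add: F_coeff_0)
next
  case (Suc N)
  let ?P = "\<lambda>y. \<Sum>i\<le>N. F_coeff lam N i * y ^ Suc i"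
  let ?P' = "\<lambda>y. \<Sum>i\<le>N. F_coeff lam N i * (real (Suc i) * y ^ i)"
  let ?y' = "- (lam * F lam t + F lam t ^ 2) / (1 + t)"
  let ?q = "- 1 / (1 + t)"
  have nz: "1 + t \<noteq> 0" using Suc.prems by simp
  have dP: "((\<lambda>t. ?P (F lam t)) has_field_derivative ?P' (F lam t) * ?y') (at t)"
  proof -
    have "(?P has_field_derivative ?P' (F lam t)) (at (F lam t))"
      by (auto intro!: derivative_eq_intros sum.cong simp del: power_Suc)
    then show ?thesis
      using DERIV_chain2 has_field_derivative_F[OF assms Suc.prems] by blast
  qed
  \<comment> \<open>Since \<open>?q\<close> has derivative \<open>?q ^ 2\<close>, its N-th power has
    derivative \<open>N * ?q ^ (N + 1)\<close>. The power rule involves the exponent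
    \<open>N - 1\<close>, so \<open>N = 0\<close> is separate.\<close>
  have dq: "((\<lambda>t. (- 1 / (1 + t)) ^ N) has_field_derivative real N * ?q ^ Suc N) (at t)"
  proof (cases N)
    case (Suc m)
    have "((\<lambda>t. - 1 / (1 + t)) has_field_derivative ?q ^ 2) (at t)"
      using nz by (auto intro!: derivative_eq_intros simp: power2_eq_square)
    from DERIV_power[OF this, of N] show ?thesis
      by (simp add: Suc power2_eq_square algebra_simps)
  qed simp
  have D: "((\<lambda>t. (- 1 / (1 + t)) ^ N * ?P (F lam t)) has_field_derivative
      real N * ?q ^ Suc N * ?P (F lam t) + ?P' (F lam t) * ?y' * ?q ^ N) (at t)"
    by (rule DERIV_mult[OF dq dP])
  have eq: "real N * ?q ^ Suc N * ?P (F lam t) + ?P' (F lam t) * ?y' * ?q ^ N =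
      ?q ^ Suc N * (\<Sum>i\<le>Suc N. F_coeff lam (Suc N) i * F lam t ^ Suc i)"
  proof -
    have y': "?y' = ?q * (lam * F lam t + F lam t ^ 2)"
      by (simp add: add_divide_distrib diff_divide_distrib)
    have alg: "n * (q * Q) * A + B * (q * X) * Q = q * Q * (n * A + X * B)" for n q Q A B X :: real
      by (simp add: algebra_simps)
    show ?thesis
      unfolding sum_F_coeff_Suc[OF assms] y' power_Suc[of ?q] by (rule alg)
  qed
  have "((deriv ^^ N) (F lam) has_field_derivative
      ?q ^ Suc N * (\<Sum>i\<le>Suc N. F_coeff lam (Suc N) i * F lam t ^ Suc i)) (at t)"
  \<comment> \<open>Differentiating the induction hypothesis needs it on a neighbourhood of
    \<open>t\<close>, hence the open domain and the arbitrary \<open>t\<close> in the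
    induction.\<close>
  proof (rule has_field_derivative_transform_within_open[OF D[unfolded eq]])
    show "open ({-1<..} - {0::real})" by (intro open_Diff) auto
    show "t \<in> {-1<..} - {0}" using Suc.prems by simp
    show "(- 1 / (1 + x)) ^ N * ?P (F lam x) = (deriv ^^ N) (F lam) x" if "x \<in> {-1<..} - {0}" for x
      using that Suc.IH[of x] by simp
  qed
  then show ?case
    by (simp only: funpow.simps o_apply DERIV_imp_deriv)
qed

lemma derivative_coeffs_F_coeff:
  assumes "lam \<noteq> 0"
  shows "derivative_coeffs lam N (F_coeff lam N)"
  unfolding derivative_coeffs_def
  by (simp add: higher_deriv_F[OF assms] atLeast0AtMost)

section \<open>Uniqueness of the coefficients\<close>

text \<open>Otherwise the differences \<open>a i - b i\<close> form a nonzero polynomial with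
  finitely many roots, yet every value of the injective \<open>F lam\<close> is a root.\<close>

lemma derivative_coeffs_unique:
  assumes "lam \<noteq> 0" "derivative_coeffs lam N a" "derivative_coeffs lam N b" "i \<le> N"
  shows "a i = b i"
proof (rule ccontr)
  assume "a i \<noteq> b i"
  then have "\<exists>i\<le>N. a i - b i \<noteq> 0" using assms by auto
  then have fin: "finite {x. (\<Sum>i\<le>N. (a i - b i) * x ^ i) = 0}"
    by (subst polyfun_finite_roots)
  let ?S = "{t. t > -1 \<and> t \<noteq> (0::real)}"
  have "F lam ` ?S \<subseteq> {x. (\<Sum>i\<le>N. (a i - b i) * x ^ i) = 0}"
  proof clarify
    fix t :: real assume t: "t > -1" "t \<noteq> 0"
    have "(- 1 / (1 + t)) ^ N * (\<Sum>i=0..N. a i * F lam t ^ (i + 1)) =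
        (- 1 / (1 + t)) ^ N * (\<Sum>i=0..N. b i * F lam t ^ (i + 1))"
      using assms(2,3)[unfolded derivative_coeffs_def, rule_format, OF t] by (rule trans[OF sym])
    then have "(\<Sum>i=0..N. a i * F lam t ^ (i + 1)) = (\<Sum>i=0..N. b i * F lam t ^ (i + 1))"
      using t by simp
    then have "F lam t * (\<Sum>i\<le>N. (a i - b i) * F lam t ^ i) = 0"
      by (simp add: sum_distrib_left sum_subtractf atLeast0AtMost algebra_simps)
    then show "(\<Sum>i\<le>N. (a i - b i) * F lam t ^ i) = 0"
      using F_nonzero[OF assms(1) t] by simp
  qed
  then have "finite ?S"
    using finite_imageD[OF finite_subset[OF _ fin] inj_on_F[OF assms(1)]] by simp
  moreover have "{0<..<1} \<subseteq> ?S" by auto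
  ultimately have "finite {0<..<1::real}" by (rule rev_finite_subset)
  then show False by (simp add: infinite_Ioo)
qed

section \<open>Degenerate Stirling numbers as finite differences\<close>

text \<open>Substituting \<open>t / lam\<close> scales the N-th coefficient by
  \<open>1 / lam ^ N\<close>. In the binomial expansion, the l-th power of
  \<open>fps_binomial lam\<close> is \<open>fps_binomial (real l * lam)\<close>, whose N-th
  coefficient is a falling factorial over \<open>fact N\<close>.\<close>

lemma degenerate_stirling2_falling_diff:
  assumes "lam \<noteq> 0"
  shows "fact k * degenerate_stirling2 (1 / lam) N k = (- 1) ^ k / lam ^ N * falling_diff lam N k"
proof -
  let ?c = "fps_const (1 / lam) * fps_X"
  \<comment> \<open>The constant 1 is fixed by substitution, so the composition can be moved outside
    the k-th power.\<close>
  have "(fps_binomial lam oo ?c) - 1 = (fps_binomial lam - 1) oo ?c"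
    by (simp add: fps_compose_sub_distrib)
  then have "fact k * degenerate_stirling2 (1 / lam) N k =
      fact N * fps_nth ((fps_binomial lam - 1) ^ k oo ?c) N"
    by (simp add: degenerate_stirling2_def degenerate_stirling2_gf_def fps_compose_power)
  also have "\<dots> = fact N / lam ^ N * fps_nth ((fps_binomial lam - 1) ^ k) N"
    by (simp only: fps_nth_compose_linear) (simp add: power_divide)
  also have "(fps_binomial lam - 1) ^ k = (\<Sum>l\<le>k. of_nat (k choose l) * fps_binomial lam ^ l * (- 1) ^ (k - l))"
    using binomial_ring[of "fps_binomial lam" "-1" k] by simp
  also have "\<dots> = (\<Sum>l\<le>k. fps_const (real (k choose l) * (- 1) ^ (k - l)) * fps_binomial (real l * lam))"
    by (intro sum.cong refl)
      (simp add: fps_binomial_power fps_of_nat[symmetric] fps_const_neg[symmetric]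
        flip: fps_const_mult fps_const_power)
  also have "fact N / lam ^ N * fps_nth \<dots> N =
      (\<Sum>l\<le>k. (- 1) ^ (k - l) * real (k choose l) * falling_factorial (lam * real l) N) / lam ^ N"
    by (simp add: fps_sum_nth falling_factorial_gbinomial sum_distrib_left sum_divide_distrib ac_simps)
  also have "\<dots> = (- 1) ^ k / lam ^ N * falling_diff lam N k"
  proof -
    have "(- 1) ^ (k - l) = (- 1) ^ k * (- 1 :: real) ^ l" if "l \<le> k" for l
      using that by (auto simp: minus_one_power_iff)
    then show ?thesis
      by (simp add: falling_diff_def sum_distrib_left sum_divide_distrib ac_simps)
  qed
  finally show ?thesis .
qed

section \<open>The two closed forms\<close>

lemma F_coeff_eq:
  "F_coeff lam N i = (- 1) ^ N / lam ^ i * (\<Sum>k=i..N. real (k choose i) * falling_diff lam N k)"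
proof -
  have "(\<Sum>k=i..N. real (k choose i) * falling_diff lam N k) =
      (\<Sum>k\<le>N. real (k choose i) * falling_diff lam N k)"
    by (intro sum.mono_neutral_left) auto
  then show ?thesis by (simp add: F_coeff_def)
qed

theorem theorem3p1:
  fixes lam :: real and N :: nat
  assumes "lam \<noteq> 0" and "N \<ge> 1"
  shows "(\<exists>a. derivative_coeffs lam N a) \<and>
    (\<forall>a. derivative_coeffs lam N a \<longrightarrow> (\<forall>i\<le>N.
       a i = (- 1) ^ N * lam powi (- int i) *
               (\<Sum>k=i..N. \<Sum>l=0..k. (- 1) ^ l * real (k choose i) * real (k choose l)
                  * falling_factorial (lam * real l) N)
     \<and> a i = (- 1) ^ N * lam ^ (N - i) *
               (\<Sum>k=i..N. (- 1) ^ k * fact k * real (k choose i)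
                  * degenerate_stirling2 (1 / lam) N k)))"
proof (intro conjI allI impI)
  show "\<exists>a. derivative_coeffs lam N a"
    using derivative_coeffs_F_coeff assms(1) by blast
next
  fix a i assume a: "derivative_coeffs lam N a" and i: "i \<le> N"
  have ai: "a i = F_coeff lam N i"
    using derivative_coeffs_unique[OF assms(1) a derivative_coeffs_F_coeff[OF assms(1)] i] .
  have "(\<Sum>k=i..N. \<Sum>l=0..k. (- 1) ^ l * real (k choose i) * real (k choose l)
                  * falling_factorial (lam * real l) N) =
      (\<Sum>k=i..N. real (k choose i) * falling_diff lam N k)"
    by (simp add: falling_diff_def sum_distrib_left atLeast0AtMost ac_simps)
  then show "a i = (- 1) ^ N * lam powi (- int i) *
               (\<Sum>k=i..N. \<Sum>l=0..k. (- 1) ^ l * real (k choose i) * real (k choose l)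
                  * falling_factorial (lam * real l) N)"
    by (simp add: ai F_coeff_eq power_int_minus divide_inverse)
  \<comment> \<open>The sign from the Stirling formula cancels the explicit
    \<open>(- 1) ^ k\<close>.\<close>
  have "(- 1) ^ k * fact k * real (k choose i) * degenerate_stirling2 (1 / lam) N k =
      1 / lam ^ N * (real (k choose i) * falling_diff lam N k)" for k
  proof -
    have "(- 1) ^ k * fact k * real (k choose i) * degenerate_stirling2 (1 / lam) N k =
        (- 1) ^ k * real (k choose i) * (fact k * degenerate_stirling2 (1 / lam) N k)"
      by simp
    also have "\<dots> = ((- 1) ^ k * (- 1) ^ k) * (1 / lam ^ N * (real (k choose i) * falling_diff lam N k))"
      unfolding degenerate_stirling2_falling_diff[OF assms(1)] by simp
    finally show ?thesis by (simp flip: power_mult_distrib)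
  qed
  then have "(\<Sum>k=i..N. (- 1) ^ k * fact k * real (k choose i) * degenerate_stirling2 (1 / lam) N k) =
      1 / lam ^ N * (\<Sum>k=i..N. real (k choose i) * falling_diff lam N k)"
    by (simp only: sum_distrib_left)
  \<comment> \<open>Trades \<open>1 / lam ^ N\<close> for the prefactor
    \<open>lam ^ (N - i)\<close>; \<open>i \<le> N\<close> makes the natural subtraction
    exact.\<close>
  moreover have "1 / lam ^ i = lam ^ (N - i) * (1 / lam ^ N)"
    using assms(1) i by (simp add: power_diff)
  ultimately show "a i = (- 1) ^ N * lam ^ (N - i) *
               (\<Sum>k=i..N. (- 1) ^ k * fact k * real (k choose i)
                  * degenerate_stirling2 (1 / lam) N k)"
    by (simp only: ai F_coeff_eq divide_inverse mult_1_left mult.assoc)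
qed

end
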